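(* Let $n\ge 5$ and $l\in\{2,3\}$. Let $A$ be the $n\times n$ upper triangular matrix with all diagonal entries equal to $1$ whose entries at the positions in $S_i$ are equal to $i \bmod 2\in\{0,1\}$, for $i=0,1,\ldots,n-l-1$. Then $A^{-1}$ is the $n\times n$ upper triangular matrix whose diagonal entries are $1$, whose entries at the positions in $S_0$ are $0$, and whose entries at the positions in $S_i$, for $1\le i\le n-l-1$, are $(-1)^iF_i$. Moreover, if $n+l$ is even then $e^TA^{-1}e=2-F_{n-1}$ (so $A$ is a minimizing matrix), and if $n+l$ is odd then $e^TA^{-1}e=2+F_{n-1}$ (so $A$ is a maximizing matrix). The equality $e^TA^{-1}e=2-F_{n-1}$ also holds for the matrix $A$ defined in the same way with $n=4$, $l=2$.
   Context: The Fibonacci numbers are $F_1=F_2=1$ and $F_k=F_{k-1}+F_{k-2}$ for $k\ge 3$. $e$ is the all-ones column vector, so $e^TXe$ is the sum of the entries of $X$. An $n\times n$ invertible upper triangular matrix $A$ with entries in $\{0,1\}$ ($n\ge3$) is called maximizing if $e^TA^{-1}e=2+F_{n-1}$ and minimizing if $e^TA^{-1}e=2-F_{n-1}$. The sets $S_0,\ldots,S_{n-l-1}$ partition the positions $(r,c)$, $1\le r<c\le n$, strictly above the diagonal, as follows: $S_{n-l-1}$ consists of the positions in the first $2$ rows and the last $l$ columns; for $i=n-l-2,\ldots,1$, $S_i$ consists of the positions immediately to the left of or immediately below positions in $S_{i+1}$ (and not already in $S_{i+1}$); $S_0$ consists of all remaining positions above the main diagonal ($1+\binom{l}{2}$ positions).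 Equivalently: partition $\{1,\ldots,n\}$ into the $n-l$ consecutive blocks $\{1,2\},\{3\},\{4\},\ldots,\{n-l\},\{n-l+1,\ldots,n\}$, numbered $1,\ldots,n-l$ in order; then $(r,c)$ with $r<c$ belongs to $S_i$ exactly when (block number of $c$) $-$ (block number of $r$) $=i$. *)

theory Defs
  imports
    Complex_Main
    "HOL-Number_Theory.Fib"
    "Jordan_Normal_Form.Gauss_Jordan_Elimination"
begin

(* Positions (r,c) are 1-based, matrix indices are 0-based: the entry of A at position (r,c)
   is A $$ (r - 1, c - 1). *)

(* S_desc n l k is the set S_(n-l-1-k): the sets are generated downwards from S_(n-l-1). *)
primrec S_desc :: "nat \<Rightarrow> nat \<Rightarrow> nat \<Rightarrow> (nat \<times> nat) set" where
  "S_desc n l 0 = {1, 2} \<times> {n - l + 1..n}"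
| "S_desc n l (Suc k) =
     {(r, c). (r, c + 1) \<in> S_desc n l k \<or> (\<exists>r'. r = r' + 1 \<and> (r', c) \<in> S_desc n l k)}
       - S_desc n l k"

definition S :: "nat \<Rightarrow> nat \<Rightarrow> nat \<Rightarrow> (nat \<times> nat) set" where
  "S n l i =
     (if i = 0
      then {(r, c). 1 \<le> r \<and> r < c \<and> c \<le> n} - (\<Union>j\<in>{1..n - l - 1}. S_desc n l (n - l - 1 - j))
      else S_desc n l (n - l - 1 - i))"

definition unit_upper_pattern :: "nat \<Rightarrow> nat \<Rightarrow> (nat \<Rightarrow> real) \<Rightarrow> real mat \<Rightarrow> bool" where
  "unit_upper_pattern n l f A \<longleftrightarrow>
     A \<in> carrier_mat n n \<and> upper_triangular A \<and>
     (\<forall>r\<in>{1..n}. A $$ (r - 1, r - 1) = 1) \<and>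
     (\<forall>i\<le>n - l - 1. \<forall>(r, c)\<in>S n l i. A $$ (r - 1, c - 1) = f i)"

(* e^T X e, for X an n x n matrix *)
definition entry_sum :: "real mat \<Rightarrow> real" where
  "entry_sum X = vec (dim_row X) (\<lambda>_. 1) \<bullet> (X *\<^sub>v vec (dim_col X) (\<lambda>_. 1))"

definition upper_triangular_01 :: "nat \<Rightarrow> real mat \<Rightarrow> bool" where
  "upper_triangular_01 n A \<longleftrightarrow>
     A \<in> carrier_mat n n \<and> upper_triangular A \<and> elements_mat A \<subseteq> {0, 1}"

(* mat_inverse A = Some B says that A is invertible with inverse B. *)
definition maximizing :: "nat \<Rightarrow> real mat \<Rightarrow> bool" where
  "maximizing n A \<longleftrightarrow> 3 \<le> n \<and> upper_triangular_01 n A \<and>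
     (\<exists>B. mat_inverse A = Some B \<and> entry_sum B = 2 + real (fib (n - 1)))"

definition minimizing :: "nat \<Rightarrow> real mat \<Rightarrow> bool" where
  "minimizing n A \<longleftrightarrow> 3 \<le> n \<and> upper_triangular_01 n A \<and>
     (\<exists>B. mat_inverse A = Some B \<and> entry_sum B = 2 - real (fib (n - 1)))"

lemma entry_sum_eq:
  "entry_sum X = (\<Sum>i<dim_row X. \<Sum>j<dim_col X. X $$ (i, j))"
  by (simp add: entry_sum_def scalar_prod_def atLeast0LessThan)

(* The number of the block of {1,2},{3},...,{n-l},{n-l+1,...,n} that contains p *)
definition block :: "nat \<Rightarrow> nat \<Rightarrow> nat \<Rightarrow> nat" where
  "block n l p = (if p \<le> 2 then 1 else if p \<le> n - l then p - 1 else n - l)"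

lemma S_desc_block:
  assumes "1 \<le> l" "l + 2 \<le> n" "k + l + 2 \<le> n"
  shows "S_desc n l k =
    {(r, c). 1 \<le> r \<and> r < c \<and> c \<le> n \<and> block n l c = block n l r + (n - l - 1 - k)}"
  using assms(3)
proof (induction k)
  case 0
  have "(r, c) \<in> S_desc n l 0 \<longleftrightarrow>
      1 \<le> r \<and> r < c \<and> c \<le> n \<and> block n l c = block n l r + (n - l - 1 - 0)" for r c
  proof -
    have "(r, c) \<in> S_desc n l 0 \<longleftrightarrow> (r = 1 \<or> r = 2) \<and> n - l + 1 \<le> c \<and> c \<le> n"
      by simp
    also have "\<dots> \<longleftrightarrow> 1 \<le> r \<and> r \<le> 2 \<and> n - l < c \<and> c \<le> n"
      by linarith
    also have "\<dots> \<longleftrightarrow>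
        1 \<le> r \<and> r < c \<and> c \<le> n \<and> block n l c = block n l r + (n - l - 1)"
    proof -
      have "1 \<le> block n l r" "block n l c \<le> n - l"
        "block n l r = 1 \<longleftrightarrow> r \<le> 2" "block n l c = n - l \<longleftrightarrow> n - l < c"
        using assms by (auto simp: block_def)
      then show ?thesis using assms(2) by linarith
    qed
    finally show ?thesis by simp
  qed
  then show ?case unfolding set_eq_iff split_paired_All mem_Collect_eq prod.case by (intro allI)
next
  case (Suc k)
  have IH: "S_desc n l k =
    {(r, c). 1 \<le> r \<and> r < c \<and> c \<le> n \<and> block n l c = block n l r + (n - l - 1 - k)}"
    using Suc by simp
  define d where "d = n - l - 1 - Suc k"
  have d: "1 \<le> d" "d + 2 \<le> n - l" "n - l - 1 - k = d + 1"
    using Suc.prems by (auto simp: d_def)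
  let ?b = "block n l"
  have IHd: "(r, c) \<in> S_desc n l k \<longleftrightarrow> 1 \<le> r \<and> r < c \<and> c \<le> n \<and> ?b c = ?b r + (d + 1)" for r c
    unfolding IH d(3) by (simp only: mem_Collect_eq prod.case)
  have step: "?b (p + 1) = ?b p \<or> ?b (p + 1) = ?b p + 1" for p
    using assms(2) by (auto simp: block_def)
  have inner: "?b p < n - l \<Longrightarrow> 2 \<le> ?b p \<Longrightarrow> 3 \<le> p \<and> ?b (p + 1) = ?b p + 1 \<and> p + 1 \<le> n"
    and inner': "?b p < n - l \<Longrightarrow> 2 \<le> ?b p \<Longrightarrow> ?b p = ?b (p - 1) + 1" for p
    using assms(1,2) by (auto simp: block_def split: if_splits)
  have le: "1 \<le> ?b p" "?b p \<le> n - l" for p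
    using assms(2) by (auto simp: block_def)
  have "(r, c) \<in> S_desc n l (Suc k) \<longleftrightarrow>
    1 \<le> r \<and> r < c \<and> c \<le> n \<and> ?b c = ?b r + d" (is "?L \<longleftrightarrow> ?R") for r c
  proof
    assume ?L
    then have no: "\<not> (1 \<le> r \<and> r < c \<and> c \<le> n \<and> ?b c = ?b r + (d + 1))"
      and yes: "(1 \<le> r \<and> r < c + 1 \<and> c + 1 \<le> n \<and> ?b (c + 1) = ?b r + (d + 1)) \<or>
        (\<exists>r'. r = r' + 1 \<and> 1 \<le> r' \<and> r' < c \<and> c \<le> n \<and> ?b c = ?b r' + (d + 1))"
      by (auto simp: IHd)
    from yes show ?R
    proof (elim disjE exE)
      assume h: "1 \<le> r \<and> r < c + 1 \<and> c + 1 \<le> n \<and> ?b (c + 1) = ?b r + (d + 1)"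
      then have "r \<noteq> c" using step[of c] d(1) by auto
      then show ?R using h no step[of c] by linarith
    next
      fix r'
      assume h: "r = r' + 1 \<and> 1 \<le> r' \<and> r' < c \<and> c \<le> n \<and> ?b c = ?b r' + (d + 1)"
      then have "r \<noteq> c" using step[of r'] d(1) by auto
      moreover have "?b r = ?b r' \<or> ?b r = ?b r' + 1" using h step[of r'] by simp
      ultimately show ?R using h no by linarith
    qed
  next
    assume R: ?R
    show ?L
    proof (cases "?b c < n - l")
      case True
      then have "?b (c + 1) = ?b c + 1" "c + 1 \<le> n"
        using inner[of c] R le(1)[of r] d(1) by auto
      then show ?thesis using R by (simp add: IHd)
    next
      case False
      then have "?b c = n - l" using le(2)[of c] by simp
      then have "?b r < n - l" "2 \<le> ?b r" using R d by auto
      then have "3 \<le> r" "?b r = ?b (r - 1) + 1" using inner[of r] inner'[of r] by auto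
      moreover obtain r' where "r = r' + 1" using \<open>3 \<le> r\<close> by (cases r) auto
      ultimately show ?thesis using R by (simp add: IHd)
    qed
  qed
  then show ?case unfolding set_eq_iff split_paired_All mem_Collect_eq prod.case d_def by (intro allI)
qed

lemma S_block:
  assumes "1 \<le> l" "l + 2 \<le> n" "i \<le> n - l - 1"
  shows "S n l i = {(r, c). 1 \<le> r \<and> r < c \<and> c \<le> n \<and> block n l c = block n l r + i}"
proof (cases "i = 0")
  case False
  then show ?thesis using assms S_desc_block[of l n "n - l - 1 - i"] by (simp add: S_def)
next
  case True
  have *: "S_desc n l (n - l - 1 - j) =
      {(r, c). 1 \<le> r \<and> r < c \<and> c \<le> n \<and> block n l c = block n l r + j}"
    if "j \<in> {1..n - l - 1}" for j
    using that assms S_desc_block[of l n "n - l - 1 - j"] by auto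
  have **: "block n l r \<le> block n l c \<and> block n l c - block n l r \<le> n - l - 1"
    if "1 \<le> r" "r < c" "c \<le> n" for r c
    using that assms by (auto simp: block_def)
  have "(\<Union>j\<in>{1..n - l - 1}. S_desc n l (n - l - 1 - j)) =
      {(r, c). 1 \<le> r \<and> r < c \<and> c \<le> n \<and> block n l c \<noteq> block n l r}"
  proof -
    have "(r, c) \<in> (\<Union>j\<in>{1..n - l - 1}. S_desc n l (n - l - 1 - j)) \<longleftrightarrow>
      (r, c) \<in> {(r, c). 1 \<le> r \<and> r < c \<and> c \<le> n \<and> block n l c \<noteq> block n l r}"
      for r c
    proof
      assume "(r, c) \<in> (\<Union>j\<in>{1..n - l - 1}. S_desc n l (n - l - 1 - j))"
      then show "(r, c) \<in> {(r, c). 1 \<le> r \<and> r < c \<and> c \<le> n \<and> block n l c \<noteq> block n l r}"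
        using * by auto
    next
      assume a: "(r, c) \<in> {(r, c). 1 \<le> r \<and> r < c \<and> c \<le> n \<and> block n l c \<noteq> block n l r}"
      let ?j = "block n l c - block n l r"
      have j: "?j \<in> {1..n - l - 1}" "block n l c = block n l r + ?j"
        using a **[of r c] by auto
      then have "(r, c) \<in> S_desc n l (n - l - 1 - ?j)"
        using a *[OF j(1)] by simp
      with j(1) show "(r, c) \<in> (\<Union>j\<in>{1..n - l - 1}. S_desc n l (n - l - 1 - j))"
        by blast
    qed
    then show ?thesis unfolding set_eq_iff split_paired_All by (intro allI)
  qed
  then show ?thesis using True by (auto simp: S_def)
qed

lemma unit_upper_pattern_unique_existence:
  assumes "1 \<le> l" "l + 2 \<le> n"
  shows "\<exists>!A. unit_upper_pattern n l f A"
proof -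
  let ?b = "block n l"
  let ?M = "mat n n (\<lambda>(i, j). if i = j then 1 else if i < j
     then f (?b (j + 1) - ?b (i + 1)) else 0)"
  have bl: "?b r \<le> ?b c \<and> ?b c - ?b r \<le> n - l - 1"
    if "1 \<le> r" "r < c" "c \<le> n" for r c
    using that assms by (auto simp: block_def)
  have ex: "unit_upper_pattern n l f ?M"
    unfolding unit_upper_pattern_def using assms
    by (auto simp: S_block upper_triangular_def)
  have "A = ?M" if A: "unit_upper_pattern n l f A" for A
  proof (rule eq_matI)
    have d: "A \<in> carrier_mat n n" "upper_triangular A"
      using A by (auto simp: unit_upper_pattern_def)
    then show "dim_row A = dim_row ?M" "dim_col A = dim_col ?M" by auto
    fix i j assume "i < dim_row ?M" "j < dim_col ?M"
    then have ij: "i < n" "j < n" by auto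
    consider "i = j" | "j < i" | "i < j" by linarith
    then show "A $$ (i, j) = ?M $$ (i, j)"
    proof cases
      case 1
      then show ?thesis using A ij
        by (auto simp: unit_upper_pattern_def dest!: bspec[of _ _ "Suc j"])
    next
      case 2
      then show ?thesis using d ij by auto
    next
      case 3
      let ?k = "?b (j + 1) - ?b (i + 1)"
      have k: "?k \<le> n - l - 1" "?b (j + 1) = ?b (i + 1) + ?k"
        using bl[of "i + 1" "j + 1"] 3 ij by auto
      then have "(i + 1, j + 1) \<in> S n l ?k"
        using assms 3 ij by (simp add: S_block)
      then have "A $$ (i, j) = f ?k"
        using A k(1) unfolding unit_upper_pattern_def by fastforce
      then show ?thesis using 3 ij by simp
    qed
  qed
  with ex show ?thesis by blast
qed

end

theory Submission
  imports Defs "Jordan_Normal_Form.Determinant"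
begin

text \<open>
  Since all blocks but the first and the last are singletons, the entries of the product of two
  block pattern matrices between different blocks are convolutions along the block distance, and
  the claimed inverse amounts to the summation formulas for Fibonacci numbers of equal index
  parity. The row of the inverse at block distance \<open>k \<ge> 1\<close> from the last block sums to
  \<open>(-1) ^ k * fib (k + l - 1)\<close> when \<open>l \<in> {2, 3}\<close>; adding the rows up
  is an alternating Fibonacci sum, in which only the first block is counted twice.
\<close>

section \<open>Alternating Fibonacci sums\<close>

definition alt_fib :: "nat \<Rightarrow> real" where
  "alt_fib d = (-1) ^ d * real (fib d)"

text \<open>\<open>alt_fib d\<close> is minus the Fibonacci number of index -d, so it obeys the
  Fibonacci recurrence run backwards.\<close>

lemma alt_fib_0 [simp]: "alt_fib 0 = 0"
  and alt_fib_1 [simp]: "alt_fib (Suc 0) = -1"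
  and alt_fib_Suc_Suc: "alt_fib (Suc (Suc d)) = alt_fib d - alt_fib (Suc d)"
  by (simp_all add: alt_fib_def algebra_simps)

text \<open>Passing from d to d + 2 preserves the parity of each d - e, and of the two new indices
  only e = d + 1, at distance 1, contributes. Hence the two-step induction.\<close>

lemma alt_fib_parity_convolution:
  "(\<Sum>e = 1..<d. real ((d - e) mod 2) * alt_fib e) = - alt_fib d - real (d mod 2)"
proof (induction d rule: fib.induct)
  case (3 d)
  show ?case
  \<comment> \<open>For d = 0 the index e = d lies below the summation range, so the two top terms
    cannot be split off.\<close>
  proof (cases "d = 0")
    case True
    then show ?thesis by (simp add: alt_fib_def numeral_2_eq_2)
  next
    case False
    have "(\<Sum>e = 1..<Suc (Suc d). real ((Suc (Suc d) - e) mod 2) * alt_fib e)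
        = (\<Sum>e = 1..<d. real ((Suc (Suc d) - e) mod 2) * alt_fib e) + alt_fib (Suc d)"
      using False by (simp add: sum.atLeastLessThan_Suc)
    also have "(\<Sum>e = 1..<d. real ((Suc (Suc d) - e) mod 2) * alt_fib e)
        = (\<Sum>e = 1..<d. real ((d - e) mod 2) * alt_fib e)"
      by (rule sum.cong) (auto simp: Suc_diff_le)
    finally show ?thesis using "3.IH"(2) by (simp add: alt_fib_Suc_Suc)
  qed
qed simp_all

text \<open>Telescoping: by the recurrence each term is
  \<open>alt_fib (d - 1) - alt_fib (d + 1)\<close>.\<close>

lemma sum_alt_fib: "(\<Sum>d = 1..<Suc k. alt_fib d) = - alt_fib k - alt_fib (Suc k) - 1"
  by (induction k) (simp_all add: alt_fib_Suc_Suc)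

text \<open>The summands are the diagonal entry, one entry per block in between and l entries in the
  last block. They add up to (-1)^k ((l - 1) F_k + F_(k-1)), which is one Fibonacci number up to
  sign because F_l = l - 1 and F_(l-1) = 1 for these l.\<close>

lemma alt_fib_row_sum:
  assumes "l \<in> {2, 3}" "1 \<le> k"
  shows "1 + (\<Sum>d = 1..<k. alt_fib d) + real l * alt_fib k = (-1) ^ k * real (fib (k + l - 1))"
proof -
  obtain j where k: "k = Suc j" using assms(2) by (cases k) auto
  show ?thesis
    using assms(1) unfolding k sum_alt_fib
    by (auto simp: alt_fib_def numeral_2_eq_2 numeral_3_eq_3 algebra_simps)
qed

text \<open>Splitting F_(k+c+1) into F_(k+c) + F_(k+c-1) makes the sum telescope.\<close>

lemma sum_alternating_fib:
  "(\<Sum>k = 1..<Suc m. (-1) ^ k * real (fib (k + Suc c))) = (-1) ^ m * real (fib (m + c)) - real (fib c)"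
  by (induction m) (simp_all add: algebra_simps)

section \<open>Entries by block distance and the product with the claimed inverse\<close>

lemma unit_upper_pattern_entry:
  assumes "1 \<le> l" "l + 2 \<le> n" "unit_upper_pattern n l f A" "i < n" "j < n"
  shows "A $$ (i, j) =
    (if i = j then 1 else if i < j then f (block n l (Suc j) - block n l (Suc i)) else 0)"
proof -
  consider "i = j" | "j < i" | "i < j" by linarith
  then show ?thesis
  proof cases
    case 1
    then show ?thesis using assms
      by (auto simp: unit_upper_pattern_def dest!: bspec[of _ _ "Suc j"])
  next
    case 2
    then show ?thesis using assms by (auto simp: unit_upper_pattern_def)
  next
    case 3
    let ?k = "block n l (Suc j) - block n l (Suc i)"
    have k: "?k \<le> n - l - 1" "block n l (Suc j) = block n l (Suc i) + ?k"
      using 3 assms by (auto simp: block_def)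
    then have "(Suc i, Suc j) \<in> S n l ?k"
      using assms 3 by (simp add: S_block)
    then have "A $$ (i, j) = f ?k"
      using assms(3) k(1) unfolding unit_upper_pattern_def by fastforce
    then show ?thesis using 3 by simp
  qed
qed

text \<open>For a and c in different blocks at distance d, the terms j = a and j = c give
  \<open>alt_fib d\<close> and \<open>d mod 2\<close>; the convolution over the blocks in between
  cancels both.\<close>

lemma unit_upper_pattern_mult_alt_fib:
  assumes l: "1 \<le> l" "l + 2 \<le> n"
    and A: "unit_upper_pattern n l (\<lambda>i. real (i mod 2)) A"
    and B: "unit_upper_pattern n l alt_fib B"
  shows "A * B = 1\<^sub>m n"
proof (rule eq_matI)
  have dim: "A \<in> carrier_mat n n" "B \<in> carrier_mat n n"
    using A B by (auto simp: unit_upper_pattern_def)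
  then show "dim_row (A * B) = dim_row (1\<^sub>m n)" "dim_col (A * B) = dim_col (1\<^sub>m n)" by auto
  define b where "b i = block n l (Suc i)" for i
  note entA = unit_upper_pattern_entry[OF l A, folded b_def]
  note entB = unit_upper_pattern_entry[OF l B, folded b_def]
  have b_mono: "b i \<le> b j" if "i \<le> j" for i j
    using that l by (auto simp: b_def block_def)
  fix a c assume "a < dim_row (1\<^sub>m n :: real mat)" "c < dim_col (1\<^sub>m n :: real mat)"
  then have ac: "a < n" "c < n" by auto
  have "(A * B) $$ (a, c) = (\<Sum>j<n. A $$ (a, j) * B $$ (j, c))"
    using ac dim by (simp add: scalar_prod_def atLeast0LessThan)
  also have "\<dots> = 1\<^sub>m n $$ (a, c)"
  proof (cases "a < c")
    case False
    \<comment> \<open>Triangularity forces a \<le> j \<le> c; the intersection treats a = c and c <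
      a together.\<close>
    have "(\<Sum>j<n. A $$ (a, j) * B $$ (j, c)) = (\<Sum>j\<in>{a} \<inter> {c}. A $$ (a, j) * B $$ (j, c))"
      by (rule sum.mono_neutral_right) (use ac False in \<open>auto simp: entA entB\<close>)
    then show ?thesis using ac by (auto simp: entA[OF ac(2) ac(2)] entB[OF ac(2) ac(2)])
  next
    case ac_less: True
    show ?thesis
    proof (cases "b a = b c")
      case True
      \<comment> \<open>Both patterns vanish at distance 0 off the diagonal, and j cannot equal both
        a and c.\<close>
      have "A $$ (a, j) * B $$ (j, c) = 0" if "j < n" for j
        using that ac ac_less True b_mono[of a j] b_mono[of j c] by (auto simp: entA entB)
      then have "(\<Sum>j<n. A $$ (a, j) * B $$ (j, c)) = 0"
        by (intro sum.neutral) blast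
      then show ?thesis using ac ac_less by simp
    next
      case False
      define d where "d = b c - b a"
      have bd: "b c = b a + d" "1 \<le> d"
        using False b_mono[of a c] ac_less by (auto simp: d_def)
      \<comment> \<open>With 0-based indices a singleton block has its own index as number, so the
        block numbers strictly between are the indices themselves.\<close>
      let ?J = "{Suc (b a)..<b c}"
      have J: "b j = j" "a < j" "j < c" "j < n" if "j \<in> ?J" for j
        using that ac l by (auto simp: b_def block_def split: if_splits)
      have J': "j \<in> ?J" if "b a < b j" "b j < b c" for j
        using that ac l by (auto simp: b_def block_def split: if_splits)
      have "(\<Sum>j<n. A $$ (a, j) * B $$ (j, c))
          = (\<Sum>j\<in>insert a (insert c ?J). A $$ (a, j) * B $$ (j, c))"
      proof (rule sum.mono_neutral_right)
        show "\<forall>j\<in>{..<n} - insert a (insert c ?J). A $$ (a, j) * B $$ (j, c) = 0"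
        proof
          fix j assume j: "j \<in> {..<n} - insert a (insert c ?J)"
          \<comment> \<open>Such a j lies outside the range from a to c, or shares a block with a or
            c without being equal to it; either way a factor is 0.\<close>
          then have "\<not> (b a < b j \<and> b j < b c)" using J'[of j] by blast
          with j ac show "A $$ (a, j) * B $$ (j, c) = 0"
            using b_mono[of a j] b_mono[of j c] by (auto simp: entA entB)
        qed
      qed (use ac J(4) in auto)
      also have "\<dots> = alt_fib d + (real (d mod 2) + (\<Sum>j\<in>?J. A $$ (a, j) * B $$ (j, c)))"
      proof -
        have "a \<notin> insert c ?J" "c \<notin> ?J" using J[of a] J[of c] ac_less by auto
        then show ?thesis using ac ac_less by (simp add: entA entB bd)
      qed
      also have "(\<Sum>j\<in>?J. A $$ (a, j) * B $$ (j, c))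
          = (\<Sum>j\<in>?J. real ((j - b a) mod 2) * alt_fib (b c - j))"
      proof (rule sum.cong)
        fix j assume "j \<in> ?J"
        note J = J[OF this]
        show "A $$ (a, j) * B $$ (j, c) = real ((j - b a) mod 2) * alt_fib (b c - j)"
          unfolding entA[OF ac(1) J(4)] entB[OF J(4) ac(2)] J(1) using J(2,3) by simp
      qed simp
      also have "\<dots> = (\<Sum>e = 1..<d. real ((d - e) mod 2) * alt_fib e)"
        by (rule sum.reindex_bij_witness[of _ "\<lambda>e. b c - e" "\<lambda>j. b c - j"])
          (auto simp: bd)
      also have "\<dots> = - alt_fib d - real (d mod 2)"
        by (rule alt_fib_parity_convolution)
      finally show ?thesis using ac ac_less by simp
    qed
  qed
  finally show "(A * B) $$ (a, c) = 1\<^sub>m n $$ (a, c)" .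
qed

section \<open>The entry sum of the inverse\<close>

lemma entry_sum_alt_fib_pattern:
  assumes l: "l \<in> {2, 3}" "l + 2 \<le> n" and B: "unit_upper_pattern n l alt_fib B"
  shows "entry_sum B = 2 - (-1) ^ (n + l) * real (fib (n - 1))"
proof -
  have l1: "1 \<le> l" using l by auto
  have dim: "dim_row B = n" "dim_col B = n"
    using B by (auto simp: unit_upper_pattern_def)
  note ent = unit_upper_pattern_entry[OF l1 l(2) B]
  \<comment> \<open>The number of blocks, and also the 0-based index of the first row in the last
    block.\<close>
  define m where "m = n - l"
  have m: "2 \<le> m" "n = m + l" using l by (auto simp: m_def)
  define R where "R k = (-1) ^ k * real (fib (k + l - 1))" for k
  have last_row: "(\<Sum>j<n. B $$ (i, j)) = 1" if i: "m \<le> i" "i < n" for i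
  proof -
    have "(\<Sum>j<n. B $$ (i, j)) = (\<Sum>j\<in>{i}. B $$ (i, j))"
      by (rule sum.mono_neutral_right) (use i m in \<open>auto simp: ent block_def\<close>)
    then show ?thesis using i by (simp add: ent)
  qed
  \<comment> \<open>Rows 0 and 1 both lie in block 1, whence the maximum.\<close>
  have row: "(\<Sum>j<n. B $$ (i, j)) = R (m - max 1 i)" if i: "i < m" for i
  proof -
    let ?p = "max 1 i"
    have p: "i \<le> ?p" "1 \<le> ?p" "?p < m" using i m by auto
    have bi: "block n l (Suc i) = ?p" using i m by (auto simp: block_def)
    \<comment> \<open>For i = 0 column 1 is in the same block and contributes 0, so the off-diagonal
      part starts at \<open>Suc ?p\<close>.\<close>
    have "(\<Sum>j<n. B $$ (i, j)) = (\<Sum>j\<in>insert i {Suc ?p..<n}. B $$ (i, j))"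
    proof (rule sum.mono_neutral_right)
      show "\<forall>j\<in>{..<n} - insert i {Suc ?p..<n}. B $$ (i, j) = 0"
      proof
        fix j assume j: "j \<in> {..<n} - insert i {Suc ?p..<n}"
        then have "j < i \<or> i < j \<and> block n l (Suc j) = ?p"
          using i m by (auto simp: block_def)
        with j show "B $$ (i, j) = 0" using i m bi by (auto simp: ent)
      qed
    qed (use i m in auto)
    also have "\<dots> = 1 + (\<Sum>j = Suc ?p..<n. B $$ (i, j))"
      using i m by (simp add: ent)
    also have "(\<Sum>j = Suc ?p..<n. B $$ (i, j))
        = (\<Sum>j = Suc ?p..<m. B $$ (i, j)) + (\<Sum>j = m..<n. B $$ (i, j))"
      using p m by (intro sum.atLeastLessThan_concat[symmetric]) auto
    also have "(\<Sum>j = m..<n. B $$ (i, j)) = (\<Sum>j = m..<n. alt_fib (m - ?p))"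
      by (rule sum.cong) (use i m bi in \<open>auto simp: ent block_def\<close>)
    also have "\<dots> = real l * alt_fib (m - ?p)" using m by simp
    also have "(\<Sum>j = Suc ?p..<m. B $$ (i, j)) = (\<Sum>j = Suc ?p..<m. alt_fib (j - ?p))"
    proof (rule sum.cong)
      fix j assume "j \<in> {Suc ?p..<m}"
      then have "i < j" "j < n" "block n l (Suc j) = j"
        using p m by (auto simp: block_def)
      then show "B $$ (i, j) = alt_fib (j - ?p)" using i m bi by (simp add: ent)
    qed simp
    also have "\<dots> = (\<Sum>d = 1..<m - ?p. alt_fib d)"
      by (rule sum.reindex_bij_witness[of _ "\<lambda>d. d + ?p" "\<lambda>j. j - ?p"]) (use p in auto)
    finally have "(\<Sum>j<n. B $$ (i, j))
        = 1 + (\<Sum>d = 1..<m - ?p. alt_fib d) + real l * alt_fib (m - ?p)"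
      by simp
    also have "\<dots> = R (m - ?p)"
      unfolding R_def by (rule alt_fib_row_sum[OF l(1)]) (use p in linarith)
    finally show ?thesis .
  qed
  have "entry_sum B = (\<Sum>i = 0..<n. \<Sum>j<n. B $$ (i, j))"
    by (simp add: entry_sum_eq dim atLeast0LessThan)
  also have "\<dots> = (\<Sum>i = 0..<m. \<Sum>j<n. B $$ (i, j)) + (\<Sum>i = m..<n. \<Sum>j<n. B $$ (i, j))"
    using m by (intro sum.atLeastLessThan_concat[symmetric]) auto
  also have "(\<Sum>i = m..<n. \<Sum>j<n. B $$ (i, j)) = real l"
    using last_row m by simp
  also have "(\<Sum>i = 0..<m. \<Sum>j<n. B $$ (i, j)) = (\<Sum>i = 0..<m. R (m - max 1 i))"
    by (rule sum.cong) (auto simp: row)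
  also have "\<dots> = R (m - 1) + (\<Sum>i = 1..<m. R (m - i))"
    using m by (simp add: sum.atLeast_Suc_lessThan max_def)
  also have "(\<Sum>i = 1..<m. R (m - i)) = (\<Sum>k = 1..<m. R k)"
    by (rule sum.reindex_bij_witness[of _ "\<lambda>k. m - k" "\<lambda>i. m - i"]) auto
  also have "\<dots> = (-1) ^ (m - 1) * real (fib (m - 1 + (l - 2))) - real (fib (l - 2))"
    using sum_alternating_fib[of "l - 2" "m - 1"] l(1) m
    by (auto simp: R_def numeral_2_eq_2 numeral_3_eq_3)
  finally have "entry_sum B = R (m - 1)
      + ((-1) ^ (m - 1) * real (fib (m - 1 + (l - 2))) - real (fib (l - 2))) + real l" .
  \<comment> \<open>This form exposes the recurrence F_(n-2) + F_(n-3) = F_(n-1), where F_(n-2)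
    comes from the doubled row. The constant l - F_(l-2) equals 2 for both values of l.\<close>
  moreover obtain q where "m = Suc (Suc q)"
    using m(1) by (metis add_2_eq_Suc le_Suc_ex)
  ultimately show ?thesis
    using l(1) m(2) by (auto simp: R_def numeral_2_eq_2 numeral_3_eq_3 algebra_simps)
qed

section \<open>Inversion and conclusion\<close>

lemma mat_inverse_eq_SomeI:
  fixes A :: "'a :: field mat"
  assumes A: "A \<in> carrier_mat n n" and B: "B \<in> carrier_mat n n" and AB: "A * B = 1\<^sub>m n"
  shows "mat_inverse A = Some B"
proof -
  have BA: "B * A = 1\<^sub>m n" using mat_mult_left_right_inverse[OF A B AB] .
  have "A \<in> Units (ring_mat TYPE('a) n ())"
    using A B AB BA by (auto simp: Units_def ring_mat_def)
  \<comment> \<open>Invertibility rules out \<open>None\<close>; uniqueness of inverses then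
    identifies \<open>C\<close> with \<open>B\<close>.\<close>
  then obtain C where C: "mat_inverse A = Some C"
    using mat_inverse(1)[OF A, where b = "()"] by (cases "mat_inverse A") auto
  then have "A * C = 1\<^sub>m n" "C \<in> carrier_mat n n"
    using mat_inverse(2)[OF A] by auto
  then have "C = B * (A * C)"
    using A B BA by (metis assoc_mult_mat left_mult_one_mat)
  then show ?thesis using C B \<open>A * C = 1\<^sub>m n\<close> by simp
qed

text \<open>The bound \<open>l + 2 \<le> n\<close> lets this serve both n \<ge> 5 and the case n =
  4, l = 2.\<close>

lemma mat_inverse_unit_upper_pattern:
  assumes "l \<in> {2, 3}" "l + 2 \<le> n" "unit_upper_pattern n l (\<lambda>i. real (i mod 2)) A"
  obtains B where "mat_inverse A = Some B" "unit_upper_pattern n l alt_fib B"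
    "entry_sum B = 2 - (-1) ^ (n + l) * real (fib (n - 1))"
proof -
  have l: "1 \<le> l" using assms(1) by auto
  obtain B where B: "unit_upper_pattern n l alt_fib B"
    using unit_upper_pattern_unique_existence[OF l assms(2)] by blast
  have "mat_inverse A = Some B"
    using unit_upper_pattern_mult_alt_fib[OF l assms(2,3) B] assms(3) B
    by (intro mat_inverse_eq_SomeI) (auto simp: unit_upper_pattern_def)
  with B entry_sum_alt_fib_pattern[OF assms(1,2) B] show thesis using that by blast
qed

lemma upper_triangular_01_unit_upper_pattern:
  assumes "1 \<le> l" "l + 2 \<le> n" "unit_upper_pattern n l (\<lambda>i. real (i mod 2)) A"
  shows "upper_triangular_01 n A"
proof -
  have "A \<in> carrier_mat n n" "upper_triangular A"
    using assms(3) by (auto simp: unit_upper_pattern_def)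
  moreover have "A $$ (i, j) \<in> {0, 1}" if "i < n" "j < n" for i j
    unfolding unit_upper_pattern_entry[OF assms that] by (auto simp: mod_2_eq_odd)
  ultimately show ?thesis
    unfolding upper_triangular_01_def by (metis carrier_matD elements_matD subsetI)
qed

theorem mainTheorem6:
  shows "(\<forall>(n::nat) (l::nat) (A::real mat).
      5 \<le> n \<and> l \<in> {2, 3} \<and> unit_upper_pattern n l (\<lambda>i. real (i mod 2)) A \<longrightarrow>
      (\<exists>B. mat_inverse A = Some B \<and>
        unit_upper_pattern n l (\<lambda>i. if i = 0 then 0 else (-1) ^ i * real (fib i)) B \<and>
        (even (n + l) \<longrightarrow> entry_sum B = 2 - real (fib (n - 1)) \<and> minimizing n A) \<and>
        (odd (n + l) \<longrightarrow> entry_sum B = 2 + real (fib (n - 1)) \<and> maximizing n A)))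
    \<and> (\<forall>A::real mat. unit_upper_pattern 4 2 (\<lambda>i. real (i mod 2)) A \<longrightarrow>
      (\<exists>B. mat_inverse A = Some B \<and> entry_sum B = 2 - real (fib (4 - 1))))"
proof (intro conjI allI impI)
  fix n l :: nat and A :: "real mat"
  assume asm: "5 \<le> n \<and> l \<in> {2, 3} \<and> unit_upper_pattern n l (\<lambda>i. real (i mod 2)) A"
  then have l: "l \<in> {2, 3}" "l + 2 \<le> n" "1 \<le> l"
    and A: "unit_upper_pattern n l (\<lambda>i. real (i mod 2)) A" by auto
  obtain B where B: "mat_inverse A = Some B" "unit_upper_pattern n l alt_fib B"
    "entry_sum B = 2 - (-1) ^ (n + l) * real (fib (n - 1))"
    using mat_inverse_unit_upper_pattern[OF l(1,2) A] .
  \<comment> \<open>Since \<open>fib 0 = 0\<close>, the closed form already yields the zero entries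
    on \<open>S n l 0\<close>.\<close>
  have "alt_fib = (\<lambda>i. if i = 0 then 0 else (-1) ^ i * real (fib i))"
    by (auto simp: alt_fib_def fun_eq_iff)
  then show "\<exists>B. mat_inverse A = Some B \<and>
        unit_upper_pattern n l (\<lambda>i. if i = 0 then 0 else (-1) ^ i * real (fib i)) B \<and>
        (even (n + l) \<longrightarrow> entry_sum B = 2 - real (fib (n - 1)) \<and> minimizing n A) \<and>
        (odd (n + l) \<longrightarrow> entry_sum B = 2 + real (fib (n - 1)) \<and> maximizing n A)"
    using B upper_triangular_01_unit_upper_pattern[OF l(3,2) A] asm
    by (intro exI[of _ B]) (auto simp: minimizing_def maximizing_def)
next
  fix A :: "real mat"
  assume "unit_upper_pattern 4 2 (\<lambda>i. real (i mod 2)) A"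
  then show "\<exists>B. mat_inverse A = Some B \<and> entry_sum B = 2 - real (fib (4 - 1))"
    using mat_inverse_unit_upper_pattern[of 2 4 A] by auto
qed

end
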